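(* Let $\mathsf{k}$ be a field, let $A=\bigoplus_{n\ge0}A_n$ be an affine $\mathbb{N}$-graded $\mathsf{k}$-algebra with all $A_n$ finite dimensional, and let $M=\bigoplus_{n\ge 0}M_n$ be a finitely generated, infinite-dimensional graded left $A$-module with all $M_n$ finite dimensional. Then: (a) If $\mathrm{H}(M)>1$, then $\operatorname{GKdim}(M)=\infty$. (b) If $\operatorname{GKdim}(M)\in(0,\infty)$, then $\mathrm{H}(M)=1$.
   Context: All algebras are associative and unital over an arbitrary base field $\mathsf{k}$; modules are left modules; $\mathbb{N}=\{0,1,2,\dots\}$. An algebra is affine if it is finitely generated as an algebra. $\mathbb{N}$-graded means $A=\bigoplus_{n\ge0}A_n$ with $A_nA_m\subseteq A_{n+m}$; a graded $A$-module is an $A$-module $M$ with subspaces $M_n$, $M=\bigoplus_{n\ge0}M_n$ and $A_iM_j\subseteq M_{i+j}$. The entropy of a graded module $M$ is $\mathrm{H}(M)=\limsup_{n\to\infty}\sqrt[n]{\dim M_n}$. For a finitely generated left module $M$ over an affine algebra $A$, choose a finite-dimensional subspace $F\subset M$ generating $M$ as an $A$-module and a frame $V$ of $A$ (a finite-dimensional subspace containing $1$ and generating $A$ as an algebra). With $V^n=\operatorname{span}\{a_1\cdots a_n:a_j\in V\}$ for $n>0$, $V^0=\mathsf{k}$, and $d_{F,V}(n)=\dim V^nF$, the Gelfand-Kirillov dimension of $M$ is $\operatorname{GKdim}(M)=\limsup_{n\to\infty}\log_n d_{F,V}(n)=\limsup_{n\to\infty}\frac{\log d_{F,V}(n)}{\log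 n}$, independent of the choices of $F$ and $V$. *)

theory Defs
  imports Complex_Main "HOL-Library.Extended_Real"
begin

definition fin_dim :: "('k::field \<Rightarrow> 'v::ab_group_add \<Rightarrow> 'v) \<Rightarrow> 'v set \<Rightarrow> bool" where
  "fin_dim scale S \<longleftrightarrow> (\<exists>B. finite B \<and> module.span scale B = S)"

text \<open>Internal direct sum: every vector is a unique finitely supported sum of components.\<close>

definition graded_space ::
    "('k::field \<Rightarrow> 'v::ab_group_add \<Rightarrow> 'v) \<Rightarrow> (nat \<Rightarrow> 'v set) \<Rightarrow> bool" where
  "graded_space scale G \<longleftrightarrow>
     (\<forall>n. module.subspace scale (G n)) \<and>
     (\<forall>x. \<exists>!c. (\<forall>n. c n \<in> G n) \<and> finite {n. c n \<noteq> 0} \<and> x = (\<Sum>n | c n \<noteq> 0. c n))"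

text \<open>The class \<open>ring_1\<close> excludes the zero ring, over which every module is zero.\<close>

locale k_algebra = vector_space scale
  for scale :: "'k::field \<Rightarrow> 'a::ring_1 \<Rightarrow> 'a" +
  assumes scale_mult_left: "scale c x * y = scale c (x * y)"
    and scale_mult_right: "x * scale c y = scale c (x * y)"
begin

definition subalgebra :: "'a set \<Rightarrow> bool" where
  "subalgebra S \<longleftrightarrow> subspace S \<and> 1 \<in> S \<and> (\<forall>x\<in>S. \<forall>y\<in>S. x * y \<in> S)"

definition affine_algebra :: bool where
  "affine_algebra \<longleftrightarrow> (\<exists>X. finite X \<and> subalgebra hull X = UNIV)"

definition frame :: "'a set \<Rightarrow> bool" where
  "frame V \<longleftrightarrow> subspace V \<and> fin_dim scale V \<and> 1 \<in> V \<and> subalgebra hull V = UNIV"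

text \<open>For \<open>n = 0\<close> only the empty product \<open>1\<close> occurs, so \<open>vpow V 0\<close> is the line of scalars.\<close>

definition vpow :: "'a set \<Rightarrow> nat \<Rightarrow> 'a set" where
  "vpow V n = span {prod_list as | as. length as = n \<and> set as \<subseteq> V}"

definition graded_algebra :: "(nat \<Rightarrow> 'a set) \<Rightarrow> bool" where
  "graded_algebra A \<longleftrightarrow> graded_space scale A \<and>
     (\<forall>i j. \<forall>a\<in>A i. \<forall>b\<in>A j. a * b \<in> A (i + j))"

end

text \<open>Left modules over a possibly noncommutative ring; the library locale \<open>module\<close>
  requires commutative scalars.\<close>

locale left_module =
  fixes act :: "'a::ring_1 \<Rightarrow> 'm::ab_group_add \<Rightarrow> 'm"
  assumes act_add_right: "act a (x + y) = act a x + act a y"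
    and act_add_left: "act (a + b) x = act a x + act b x"
    and act_mult: "act (a * b) x = act a (act b x)"
    and act_one: "act 1 x = x"
begin

definition submodule :: "'m set \<Rightarrow> bool" where
  "submodule N \<longleftrightarrow> 0 \<in> N \<and> (\<forall>x\<in>N. \<forall>y\<in>N. x + y \<in> N) \<and> (\<forall>a. \<forall>x\<in>N. act a x \<in> N)"

definition fin_gen :: bool where
  "fin_gen \<longleftrightarrow> (\<exists>X. finite X \<and> submodule hull X = UNIV)"

end

locale k_algebra_module = k_algebra scale + left_module act
  for scale :: "'k::field \<Rightarrow> 'a::ring_1 \<Rightarrow> 'a"
    and act :: "'a \<Rightarrow> 'm::ab_group_add \<Rightarrow> 'm"
begin

text \<open>The vector space structure of a module is the one induced along
  \<open>c \<mapsto> scale c 1\<close>.\<close>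

definition mscale :: "'k \<Rightarrow> 'm \<Rightarrow> 'm" where
  "mscale c x = act (scale c 1) x"

sublocale MV: vector_space mscale
proof
  fix a b :: 'k and x y :: 'm
  show "mscale a (x + y) = mscale a x + mscale a y"
    by (simp add: mscale_def act_add_right)
  show "mscale (a + b) x = mscale a x + mscale b x"
    by (simp add: mscale_def scale_left_distrib act_add_left)
  show "mscale a (mscale b x) = mscale (a * b) x"
    by (simp add: mscale_def act_mult [symmetric] scale_mult_left)
  show "mscale 1 x = x"
    by (simp add: mscale_def act_one)
qed

definition graded_module :: "(nat \<Rightarrow> 'a set) \<Rightarrow> (nat \<Rightarrow> 'm set) \<Rightarrow> bool" where
  "graded_module A M \<longleftrightarrow> graded_space mscale M \<and>
     (\<forall>i j. \<forall>a\<in>A i. \<forall>x\<in>M j. act a x \<in> M (i + j))"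

definition entropy :: "(nat \<Rightarrow> 'm set) \<Rightarrow> ereal" where
  "entropy M = limsup (\<lambda>n. ereal (root n (real (MV.dim (M n)))))"

definition generating_subspace :: "'m set \<Rightarrow> bool" where
  "generating_subspace F \<longleftrightarrow>
     MV.subspace F \<and> fin_dim mscale F \<and> submodule hull F = UNIV"

definition growth :: "'m set \<Rightarrow> 'a set \<Rightarrow> nat \<Rightarrow> nat" where
  "growth F V n = MV.dim (MV.span {act a x | a x. a \<in> vpow V n \<and> x \<in> F})"

definition GKdim_wrt :: "'m set \<Rightarrow> 'a set \<Rightarrow> ereal" where
  "GKdim_wrt F V = limsup (\<lambda>n. ereal (log (real n) (real (growth F V n))))"

text \<open>\<open>GKdim_wrt F V\<close> does not depend on the choice of \<open>F\<close> and \<open>V\<close>. Such a pair exists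
  whenever the algebra is affine and the module finitely generated; the definition is only
  meaningful in that case.\<close>

definition GKdim :: ereal where
  "GKdim = (SOME d. \<exists>F V. generating_subspace F \<and> frame V \<and> d = GKdim_wrt F V)"

end

end

theory Submission
  imports Defs "HOL-Real_Asymp.Real_Asymp"
begin

text \<open>
  The point is a linear bound on the word length needed to reach a given degree: for every
  finite-dimensional generating subspace \<open>F\<close> and every frame \<open>V\<close> there are \<open>r\<close> and \<open>s\<close> with
  \<open>M\<^sub>n \<subseteq> V\<^sup>r\<^sup>n\<^sup>+\<^sup>s F\<close> for all \<open>n\<close> (\<open>component_subset_growth_space\<close>). Hence \<open>dim M\<^sub>n\<close> is at most the
  growth function at \<open>r n + s\<close>. If the entropy exceeds \<open>1\<close>, then \<open>dim M\<^sub>n > c\<^sup>n\<close> infinitely often for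
  some \<open>c > 1\<close>, so the growth function is bounded by no power of its argument and the
  Gelfand-Kirillov dimension is infinite.

  The bound comes from a recursion on degrees (\<open>high_degree_recursion\<close>): if \<open>V\<close> lives in degrees up
  to \<open>D\<close> and \<open>F\<close> in degrees up to \<open>E\<close>, then \<open>M\<^sub>n\<close> is the sum of the \<open>A\<^sub>i M\<^sub>n\<^sub>-\<^sub>i\<close> with \<open>1 \<le> i \<le> D\<close> as soon as
  \<open>n > E\<close>. Every step of the recursion lowers the degree by at least one and costs a factor in some
  \<open>A\<^sub>i\<close> with \<open>i \<le> D\<close>; these finitely many finite-dimensional spaces all lie in one power \<open>V\<^sup>r\<close>. Factors
  of degree \<open>0\<close>, of which a word may contain arbitrarily many, are harmless because \<open>A\<^sub>0 A\<^sub>i \<subseteq> A\<^sub>i\<close>.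

  For the second claim, the entropy is at most \<open>1\<close> by the first one. It is at least \<open>1\<close>
  because an infinite-dimensional \<open>M\<close> has infinitely many nonzero components, each of dimension
  at least \<open>1\<close>.
\<close>

section \<open>Graded vector spaces\<close>

lemma finite_subset_chain_member:
  fixes U :: "nat \<Rightarrow> 'b set"
  assumes "finite B" "mono U" "B \<subseteq> (\<Union>n. U n)"
  shows "\<exists>n. B \<subseteq> U n"
  using assms(1,3)
proof (induction B)
  case empty
  then show ?case by simp
next
  case (insert b B)
  then obtain m n where "B \<subseteq> U n" "b \<in> U m" by auto
  moreover have "U n \<subseteq> U (max m n)" "U m \<subseteq> U (max m n)"
    using assms(2) by (auto simp: mono_def)
  ultimately show ?case by blast
qed

context vector_space
begin

lemma subspace_UN_chain:
  assumes "mono U" "\<And>n::nat. subspace (U n)"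
  shows "subspace (\<Union>n. U n)"
proof -
  have "x + y \<in> (\<Union>n. U n)" if "x \<in> U m" "y \<in> U n" for x y m n
  proof -
    have "x \<in> U (max m n)" "y \<in> U (max m n)"
      using that monoD[OF assms(1), of m "max m n"] monoD[OF assms(1), of n "max m n"] by auto
    then show ?thesis using assms(2) by (blast intro: subspace_add)
  qed
  moreover have "0 \<in> (\<Union>n. U n)"
    using subspace_0[OF assms(2)] by auto
  moreover have "scale c x \<in> (\<Union>n. U n)" if "x \<in> (\<Union>n. U n)" for c x
    using that by (auto dest: subspace_scale[OF assms(2)])
  ultimately show ?thesis
    unfolding subspace_def by auto
qed

lemma dim_mono_finite_span:
  assumes "S \<subseteq> T" "T \<subseteq> span W" "finite W"
  shows "dim S \<le> dim T"
proof -
  obtain B where B: "B \<subseteq> T" "independent B" "T \<subseteq> span B" "card B = dim T"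
    using basis_exists by blast
  have "finite B"
    using independent_span_bound[OF assms(3) B(2)] B(1) assms(2) by blast
  then show ?thesis
    using dim_le_card[of S B] B assms(1) by auto
qed

lemma graded_space_subspace: "graded_space scale G \<Longrightarrow> subspace (G n)"
  by (simp add: graded_space_def)

lemma graded_space_bounded_degree:
  assumes "graded_space scale G"
  shows "\<exists>D. x \<in> span (\<Union>i\<le>D. G i)"
proof -
  obtain c where c: "\<forall>n. c n \<in> G n" "finite {n. c n \<noteq> 0}" "x = (\<Sum>n | c n \<noteq> 0. c n)"
    using assms unfolding graded_space_def by blast
  obtain D where D: "{n. c n \<noteq> 0} \<subseteq> {..D}"
    using c(2) by (meson finite_nat_iff_bounded_le)
  have "x \<in> span (\<Union>i\<le>D. G i)"
    unfolding c(3) using c(1) D by (intro span_sum span_base) blast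
  then show ?thesis ..
qed

lemma graded_space_fin_dim_bounded_degree:
  assumes "graded_space scale G" "fin_dim scale S"
  shows "\<exists>D. S \<subseteq> span (\<Union>i\<le>D. G i)"
proof -
  obtain B where B: "finite B" "span B = S"
    using assms(2) by (auto simp: fin_dim_def)
  have "mono (\<lambda>D. span (\<Union>i\<le>D. G i))"
    by (intro monoI span_mono) force
  then have "\<exists>D. B \<subseteq> span (\<Union>i\<le>D. G i)"
    using B(1) graded_space_bounded_degree[OF assms(1)]
    by (intro finite_subset_chain_member) auto
  then show ?thesis
    using B(2) span_minimal by blast
qed

lemma span_UN_finite_support:
  assumes "x \<in> span (\<Union>n::nat. P n)" "\<And>n. subspace (P n)"
  shows "\<exists>c N. (\<forall>n. c n \<in> P n) \<and> (\<forall>n>N. c n = 0) \<and> x = (\<Sum>n\<le>N. c n)"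
  using assms(1)
proof (induction rule: span_induct_alt)
  case base
  then show ?case
    using assms(2) by (intro exI[of _ "\<lambda>_. 0"] exI[of _ 0]) (auto simp: subspace_0)
next
  case (step k x y)
  then obtain c N where c: "\<forall>n. c n \<in> P n" "\<forall>n>N. c n = 0" "y = (\<Sum>n\<le>N. c n)" by blast
  obtain m where m: "x \<in> P m" using step by blast
  define d where "d = (\<lambda>n. (if n = m then scale k x else 0) + c n)"
  have "(\<Sum>n\<le>max m N. d n) = scale k x + (\<Sum>n\<le>max m N. c n)"
    by (simp add: d_def sum.distrib)
  also have "(\<Sum>n\<le>max m N. c n) = (\<Sum>n\<le>N. c n)"
    using c(2) by (intro sum.mono_neutral_right) auto
  finally have "scale k x + y = (\<Sum>n\<le>max m N. d n)" using c(3) by simp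
  moreover have "\<forall>n. d n \<in> P n"
    using m c(1) assms(2) by (auto simp: d_def subspace_add subspace_scale)
  moreover have "\<forall>n>max m N. d n = 0"
    using c(2) by (auto simp: d_def)
  ultimately show ?case by blast
qed

text \<open>Uniqueness of homogeneous decompositions: subspaces of the components that still
  span everything cannot be proper.\<close>

lemma graded_space_component_eqI:
  assumes "graded_space scale G" "\<And>n. subspace (P n)" "\<And>n. P n \<subseteq> G n"
    and "span (\<Union>n. P n) = UNIV"
  shows "P n = G n"
proof
  show "G n \<subseteq> P n"
  proof
    fix x assume x: "x \<in> G n"
    obtain c N where c: "\<forall>n. c n \<in> P n" "\<forall>n>N. c n = 0" "x = (\<Sum>n\<le>N. c n)"
      using span_UN_finite_support[of x P] assms(2,4) by auto
    have sub: "{n. c n \<noteq> 0} \<subseteq> {..N}"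
      using c(2) by (auto simp: not_less[symmetric])
    define dec where
      "dec c \<longleftrightarrow> (\<forall>n. c n \<in> G n) \<and> finite {n. c n \<noteq> 0} \<and> x = (\<Sum>n | c n \<noteq> 0. c n)" for c
    have "dec c"
      unfolding dec_def
    proof (intro conjI)
      show "\<forall>n. c n \<in> G n" using c(1) assms(3) by blast
      show "finite {n. c n \<noteq> 0}" using sub finite_subset by blast
      show "x = (\<Sum>n | c n \<noteq> 0. c n)"
        unfolding c(3) using sub by (intro sum.mono_neutral_right) auto
    qed
    moreover have "dec (\<lambda>k. if k = n then x else 0)"
    proof -
      have "{k. (if k = n then x else 0) \<noteq> 0} = (if x = 0 then {} else {n})" by auto
      then show ?thesis
        unfolding dec_def
        using x graded_space_subspace[OF assms(1)] by (auto simp: subspace_0)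
    qed
    moreover have "\<exists>!c. dec c"
      unfolding dec_def
      by (rule assms(1)[unfolded graded_space_def, THEN conjunct2, THEN spec, of x])
    ultimately have "c = (\<lambda>k. if k = n then x else 0)" by blast
    then have "c n = x" by simp
    then show "x \<in> P n" using c(1) by metis
  qed
qed (use assms(3) in blast)

text \<open>Otherwise bases of the finitely many nonzero components would together span the
  whole space.\<close>

lemma graded_space_infinitely_many_nonzero:
  assumes "graded_space scale G" "\<And>n. fin_dim scale (G n)" "\<not> fin_dim scale UNIV"
  shows "\<exists>n\<ge>N. dim (G n) \<ge> 1"
proof (rule ccontr)
  assume *: "\<not> ?thesis"
  have zero: "G n \<subseteq> {0}" if "n \<ge> N" for n
  proof -
    obtain B where B: "finite B" "span B = G n"
      using assms(2)[of n] by (auto simp: fin_dim_def)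
    obtain C where C: "C \<subseteq> G n" "independent C" "G n \<subseteq> span C" "card C = dim (G n)"
      using basis_exists by blast
    have "dim (G n) = 0" using * that by auto
    moreover have "finite C" using independent_span_bound[OF B(1) C(2)] B C by blast
    ultimately show ?thesis using C by auto
  qed
  obtain B where B: "\<And>n. finite (B n)" "\<And>n. span (B n) = G n"
    using assms(2) unfolding fin_dim_def by metis
  have "x \<in> span (\<Union>i<N. B i)" for x
  proof -
    obtain D where D: "x \<in> span (\<Union>i\<le>D. G i)"
      using graded_space_bounded_degree[OF assms(1)] by blast
    have "G i \<subseteq> span (\<Union>i<N. B i)" for i
    proof (cases "i < N")
      case True
      then have "span (B i) \<subseteq> span (\<Union>i<N. B i)" by (intro span_mono) blast
      then show ?thesis using B(2) by simp
    next
      case False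
      then show ?thesis using zero[of i] span_zero by auto
    qed
    then have "span (\<Union>i\<le>D. G i) \<subseteq> span (\<Union>i<N. B i)"
      by (intro span_minimal) auto
    then show ?thesis using D by blast
  qed
  then have "fin_dim scale UNIV"
    unfolding fin_dim_def using B(1) by (intro exI[of _ "\<Union>i<N. B i"]) auto
  then show False using assms(3) by blast
qed

end

section \<open>Powers of a frame\<close>

context k_algebra
begin

lemma mult_span_induct:
  assumes "a \<in> span S" "b \<in> span T" "subspace Q" "\<And>s t. s \<in> S \<Longrightarrow> t \<in> T \<Longrightarrow> s * t \<in> Q"
  shows "a * b \<in> Q"
proof -
  have "s * b \<in> Q" if "s \<in> S" for s
    using assms(2)
  proof (induction rule: span_induct_alt)
    case base
    then show ?case using assms(3) by (simp add: subspace_0)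
  next
    case (step c x y)
    then show ?case using assms(3,4) that
      by (auto simp: distrib_left scale_mult_right intro!: subspace_add subspace_scale)
  qed
  with assms(1) show ?thesis
  proof (induction rule: span_induct_alt)
    case base
    then show ?case using assms(3) by (simp add: subspace_0)
  next
    case (step c x y)
    then show ?case using assms(3)
      by (auto simp: distrib_right scale_mult_left intro!: subspace_add subspace_scale)
  qed
qed

lemma subspace_vpow: "subspace (vpow V n)"
  by (simp add: vpow_def)

lemma vpow_mult: "a \<in> vpow V m \<Longrightarrow> b \<in> vpow V n \<Longrightarrow> a * b \<in> vpow V (m + n)"
  unfolding vpow_def
proof (erule mult_span_induct, assumption, simp)
  fix s t
  assume "s \<in> {prod_list as |as. length as = m \<and> set as \<subseteq> V}"
    and "t \<in> {prod_list as |as. length as = n \<and> set as \<subseteq> V}"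
  then obtain as bs where "s = prod_list as" "t = prod_list bs" "length as = m" "length bs = n"
    "set as \<subseteq> V" "set bs \<subseteq> V" by auto
  then show "s * t \<in> span {prod_list as |as. length as = m + n \<and> set as \<subseteq> V}"
    by (intro span_base CollectI exI[of _ "as @ bs"]) auto
qed

lemma one_in_vpow: "1 \<in> V \<Longrightarrow> 1 \<in> vpow V n"
  unfolding vpow_def
  by (rule span_base, rule CollectI, rule exI[of _ "replicate n 1"]) auto

lemma mono_vpow:
  assumes "1 \<in> V"
  shows "mono (vpow V)"
proof (rule monoI, rule subsetI)
  fix m n :: nat and a
  assume "m \<le> n" "a \<in> vpow V m"
  then show "a \<in> vpow V n"
    using vpow_mult[of a V m 1 "n - m"] one_in_vpow[OF assms] by simp
qed

lemma UN_vpow: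
  assumes "frame V"
  shows "(\<Union>n. vpow V n) = UNIV"
proof -
  have one: "1 \<in> V" using assms by (simp add: frame_def)
  have "subspace (\<Union>n. vpow V n)"
    by (rule subspace_UN_chain[OF mono_vpow[OF one] subspace_vpow])
  moreover have "x * y \<in> (\<Union>n. vpow V n)"
    if "x \<in> (\<Union>n. vpow V n)" "y \<in> (\<Union>n. vpow V n)" for x y
    using that by (auto dest: vpow_mult)
  ultimately have "subalgebra (\<Union>n. vpow V n)"
    unfolding subalgebra_def using one_in_vpow[OF one] by auto
  moreover have "V \<subseteq> vpow V 1"
  proof
    fix v assume "v \<in> V"
    then show "v \<in> vpow V 1"
      unfolding vpow_def by (intro span_base CollectI exI[of _ "[v]"]) auto
  qed
  ultimately have "subalgebra hull V \<subseteq> (\<Union>n. vpow V n)"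
    by (intro hull_minimal) auto
  then show ?thesis using assms unfolding frame_def by blast
qed

text \<open>Expanding the factors in a spanning set of \<open>V\<close>, a power of \<open>V\<close> is spanned by
  the words of the given length in that spanning set, which are finitely many.\<close>

lemma vpow_finite_span:
  assumes "fin_dim scale V"
  shows "\<exists>S. finite S \<and> vpow V n \<subseteq> span S"
proof -
  obtain B where B: "finite B" "span B = V"
    using assms by (auto simp: fin_dim_def)
  define S where "S n = prod_list ` {bs. set bs \<subseteq> B \<and> length bs = n}" for n
  have words: "prod_list as \<in> span (S (length as))" if "set as \<subseteq> V" for as
    using that
  proof (induction as)
    case Nil
    have "prod_list [] \<in> S 0" unfolding S_def by (rule imageI) simp
    then show ?case by (auto intro: span_base)
  next
    case (Cons a as)
    have "s * t \<in> span (S (Suc (length as)))" if st: "s \<in> B" "t \<in> S (length as)" for s t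
    proof -
      from st(2) obtain bs where "t = prod_list bs" "set bs \<subseteq> B" "length bs = length as"
        by (auto simp: S_def)
      then have "s * t \<in> S (Suc (length as))"
        unfolding S_def using st(1) by (intro image_eqI[of _ _ "s # bs"]) auto
      then show ?thesis by (rule span_base)
    qed
    moreover have "a \<in> span B" using Cons.prems B(2) by auto
    moreover have "prod_list as \<in> span (S (length as))" using Cons by simp
    ultimately show ?case
      using mult_span_induct[of a B "prod_list as" "S (length as)"] by simp
  qed
  have "vpow V n \<subseteq> span (S n)"
    unfolding vpow_def using words by (intro span_minimal) auto
  moreover have "finite (S n)"
    unfolding S_def using finite_lists_length_eq[OF B(1)] by simp
  ultimately show ?thesis by blast
qed

lemma affine_algebra_frame_exists:
  assumes affine_algebra
  shows "\<exists>V. frame V"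
proof -
  obtain X where X: "finite X" "subalgebra hull X = UNIV"
    using assms by (auto simp: affine_algebra_def)
  have "X \<subseteq> span (insert 1 X)" using span_superset by blast
  then have "subalgebra hull X \<subseteq> subalgebra hull (span (insert 1 X))" by (rule hull_mono)
  then have "subalgebra hull (span (insert 1 X)) = UNIV" using X(2) by auto
  moreover have "fin_dim scale (span (insert 1 X))"
    unfolding fin_dim_def using X(1) by blast
  ultimately have "frame (span (insert 1 X))"
    unfolding frame_def by (simp add: span_base)
  then show ?thesis ..
qed

end

section \<open>The filtration of a module by word length\<close>

context k_algebra_module
begin

lemma act_zero_right [simp]: "act a 0 = 0"
  using act_add_right[of a 0 0] by simp

lemma act_zero_left [simp]: "act 0 x = 0"
  using act_add_left[of 0 0 x] by simp

lemma act_scale: "act (scale c a) x = mscale c (act a x)"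
  by (simp add: mscale_def act_mult[symmetric] scale_mult_left)

lemma act_mscale: "act a (mscale c x) = mscale c (act a x)"
  by (simp add: mscale_def act_mult[symmetric] scale_mult_left scale_mult_right)

lemma act_right_span_induct:
  assumes "x \<in> MV.span T" "MV.subspace Q" "\<And>t. t \<in> T \<Longrightarrow> act a t \<in> Q"
  shows "act a x \<in> Q"
  using assms(1)
proof (induction rule: MV.span_induct_alt)
  case base
  then show ?case using assms(2) by (simp add: MV.subspace_0)
next
  case (step c x y)
  then show ?case using assms(2,3)
    by (auto simp: act_add_right act_mscale intro!: MV.subspace_add MV.subspace_scale)
qed

lemma act_left_span_induct:
  assumes "a \<in> span S" "MV.subspace Q" "\<And>s. s \<in> S \<Longrightarrow> act s x \<in> Q"
  shows "act a x \<in> Q"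
  using assms(1)
proof (induction rule: span_induct_alt)
  case base
  then show ?case using assms(2) by (simp add: MV.subspace_0)
next
  case (step c a b)
  then show ?case using assms(2,3)
    by (auto simp: act_add_left act_scale intro!: MV.subspace_add MV.subspace_scale)
qed

definition growth_space :: "'m set \<Rightarrow> 'a set \<Rightarrow> nat \<Rightarrow> 'm set" where
  "growth_space F V n = MV.span {act a x | a x. a \<in> vpow V n \<and> x \<in> F}"

lemma growth_eq_dim: "growth F V n = MV.dim (growth_space F V n)"
  by (simp add: growth_def growth_space_def)

lemma subspace_growth_space: "MV.subspace (growth_space F V n)"
  by (simp add: growth_space_def)

lemma mono_growth_space:
  assumes "1 \<in> V"
  shows "mono (growth_space F V)"
proof (rule monoI)
  fix m n :: nat
  assume "m \<le> n"
  then have "vpow V m \<subseteq> vpow V n" using mono_vpow[OF assms] by (auto dest: monoD)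
  then show "growth_space F V m \<subseteq> growth_space F V n"
    unfolding growth_space_def by (intro MV.span_mono) blast
qed

lemma act_growth_space:
  assumes "a \<in> vpow V m" "x \<in> growth_space F V n"
  shows "act a x \<in> growth_space F V (m + n)"
  using assms(2) subspace_growth_space unfolding growth_space_def[of F V n]
proof (rule act_right_span_induct)
  fix t assume "t \<in> {act a x |a x. a \<in> vpow V n \<and> x \<in> F}"
  then obtain b y where "t = act b y" "b \<in> vpow V n" "y \<in> F" by blast
  then show "act a t \<in> growth_space F V (m + n)"
    unfolding growth_space_def using vpow_mult[OF assms(1)]
    by (intro MV.span_base CollectI exI[of _ "a * b"] exI[of _ y]) (simp add: act_mult)
qed

lemma UN_growth_space:
  assumes "generating_subspace F" "frame V"
  shows "(\<Union>n. growth_space F V n) = UNIV"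
proof -
  have one: "1 \<in> V" using assms(2) by (simp add: frame_def)
  have sub: "MV.subspace (\<Union>n. growth_space F V n)"
    by (rule MV.subspace_UN_chain[OF mono_growth_space[OF one] subspace_growth_space])
  have "act a x \<in> (\<Union>n. growth_space F V n)" if x: "x \<in> (\<Union>n. growth_space F V n)" for a x
  proof -
    obtain m where "a \<in> vpow V m" using UN_vpow[OF assms(2)] by blast
    then show ?thesis using x by (auto dest: act_growth_space)
  qed
  then have "submodule (\<Union>n. growth_space F V n)"
    unfolding submodule_def
    using MV.subspace_0[OF sub] MV.subspace_add[OF sub] by (intro conjI ballI allI)
  moreover have "F \<subseteq> growth_space F V 0"
  proof
    fix x assume "x \<in> F"
    then show "x \<in> growth_space F V 0"
      unfolding growth_space_def using one_in_vpow[OF one]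
      by (intro MV.span_base CollectI exI[of _ 1] exI[of _ x]) (simp add: act_one)
  qed
  ultimately have "submodule hull F \<subseteq> (\<Union>n. growth_space F V n)"
    by (intro hull_minimal) auto
  then show ?thesis using assms(1) unfolding generating_subspace_def by blast
qed

lemma growth_space_finite_span:
  assumes "fin_dim mscale F" "fin_dim scale V"
  shows "\<exists>W. finite W \<and> growth_space F V n \<subseteq> MV.span W"
proof -
  obtain B where B: "finite B" "MV.span B = F"
    using assms(1) by (auto simp: fin_dim_def)
  obtain S where S: "finite S" "vpow V n \<subseteq> span S"
    using vpow_finite_span[OF assms(2)] by blast
  let ?W = "(\<lambda>(s, b). act s b) ` (S \<times> B)"
  have "act a x \<in> MV.span ?W" if "a \<in> vpow V n" "x \<in> F" for a x
  proof -
    have "act a b \<in> MV.span ?W" if "b \<in> B" for b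
      using \<open>a \<in> vpow V n\<close> S(2) that
      by (intro act_left_span_induct[of a S]) (auto intro: MV.span_base)
    then show ?thesis
      using that(2) B(2) by (intro act_right_span_induct[of x B]) auto
  qed
  then have "growth_space F V n \<subseteq> MV.span ?W"
    unfolding growth_space_def by (intro MV.span_minimal) auto
  moreover have "finite ?W" using B(1) S(1) by simp
  ultimately show ?thesis by blast
qed

lemma fin_gen_generating_subspace_exists:
  assumes fin_gen
  shows "\<exists>F. generating_subspace F"
proof -
  obtain X where X: "finite X" "submodule hull X = UNIV"
    using assms by (auto simp: fin_gen_def)
  have "submodule hull X \<subseteq> submodule hull (MV.span X)"
    by (rule hull_mono) (rule MV.span_superset)
  then have "submodule hull (MV.span X) = UNIV" using X(2) by auto
  moreover have "fin_dim mscale (MV.span X)"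
    unfolding fin_dim_def using X(1) by blast
  ultimately have "generating_subspace (MV.span X)"
    unfolding generating_subspace_def by simp
  then show ?thesis ..
qed

section \<open>Word length is linear in the degree\<close>

text \<open>Let \<open>P\<^sub>k\<close> be \<open>M\<^sub>k\<close> for \<open>k \<le> E\<close> and the right-hand side for \<open>k > E\<close>. The sum of the \<open>P\<^sub>k\<close> contains \<open>F\<close>
  and is stable under each \<open>A\<^sub>i\<close> with \<open>i \<le> D\<close>: for \<open>i > 0\<close> because \<open>A\<^sub>i M\<^sub>j\<close> is one of the summands of
  \<open>P\<^sub>i\<^sub>+\<^sub>j\<close>, and for \<open>i = 0\<close> because \<open>A\<^sub>0 A\<^sub>j \<subseteq> A\<^sub>j\<close>. As these \<open>A\<^sub>i\<close> generate the algebra, the sum is a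
  submodule, hence everything, and then \<open>P\<^sub>k = M\<^sub>k\<close> by uniqueness of homogeneous decompositions.\<close>

lemma high_degree_recursion:
  assumes A: "graded_algebra A" and M: "graded_module A M"
    and F: "submodule hull F = UNIV" "F \<subseteq> MV.span (\<Union>k\<le>E. M k)"
    and V: "subalgebra hull V = UNIV" "V \<subseteq> span (\<Union>i\<le>D. A i)"
    and n: "n > E"
  shows "M n = MV.span {act a x | a x i j. 1 \<le> i \<and> i \<le> D \<and> i + j = n \<and> a \<in> A i \<and> x \<in> M j}"
proof -
  define R where
    "R k = {act a x | a x i j. 1 \<le> i \<and> i \<le> D \<and> i + j = k \<and> a \<in> A i \<and> x \<in> M j}" for k
  define P where "P k = (if k \<le> E then M k else MV.span (R k))" for k
  let ?P = "MV.span (\<Union>k. P k)"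
  have grM: "graded_space mscale M"
    and actM: "\<And>i j a x. a \<in> A i \<Longrightarrow> x \<in> M j \<Longrightarrow> act a x \<in> M (i + j)"
    using M by (auto simp: graded_module_def)
  have multA: "\<And>i j a b. a \<in> A i \<Longrightarrow> b \<in> A j \<Longrightarrow> a * b \<in> A (i + j)"
    using A by (auto simp: graded_algebra_def)
  have subM: "MV.subspace (M k)" for k
    using MV.graded_space_subspace[OF grM] .
  have subP: "MV.subspace (P k)" for k
    using subM by (simp add: P_def)
  have RM: "R k \<subseteq> M k" for k
    using actM by (auto simp: R_def)
  have PM: "P k \<subseteq> M k" for k
    using MV.span_minimal[OF RM subM] by (simp add: P_def)
  have zero_step: "act a x \<in> P k" if a: "a \<in> A 0" and x: "x \<in> P k" for a x k
  proof (cases "k \<le> E")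
    case True
    then show ?thesis using actM[OF a] x by (fastforce simp: P_def)
  next
    case False
    have "act a t \<in> MV.span (R k)" if "t \<in> R k" for t
    proof -
      from that obtain b y i j where t: "t = act b y" "1 \<le> i" "i \<le> D" "i + j = k"
        "b \<in> A i" "y \<in> M j" by (auto simp: R_def)
      have "a * b \<in> A i" using multA[OF a t(5)] by simp
      then have "act (a * b) y \<in> R k" using t unfolding R_def by blast
      then show ?thesis using t(1) by (auto simp: act_mult intro: MV.span_base)
    qed
    then show ?thesis
      using x False act_right_span_induct[of x "R k" "MV.span (R k)" a] by (simp add: P_def)
  qed
  have step: "act a x \<in> P (i + k)" if a: "a \<in> A i" and i: "i \<le> D" and x: "x \<in> P k" for a x i k
  proof (cases "i = 0")
    case True
    then show ?thesis using zero_step a x by simp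
  next
    case False
    have xM: "x \<in> M k" using x PM by blast
    show ?thesis
    proof (cases "i + k \<le> E")
      case True
      then show ?thesis using actM[OF a xM] by (simp add: P_def)
    next
      case False
      have "act a x \<in> R (i + k)"
        unfolding R_def using \<open>i \<noteq> 0\<close> a i xM by (auto simp: Suc_le_eq)
      then show ?thesis using False by (auto simp: P_def intro: MV.span_base)
    qed
  qed
  have stable_V: "act a x \<in> ?P" if "a \<in> V" "x \<in> ?P" for a x
  proof -
    have "act b x \<in> ?P" if "b \<in> (\<Union>i\<le>D. A i)" for b
      using \<open>x \<in> ?P\<close>
    proof (rule act_right_span_induct)
      fix t assume "t \<in> (\<Union>k. P k)"
      with that step show "act b t \<in> ?P" by (blast intro: MV.span_base)
    qed simp
    then show ?thesis
      using \<open>a \<in> V\<close> V(2) by (intro act_left_span_induct[of a "\<Union>i\<le>D. A i"]) auto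
  qed
  have "subalgebra {a. \<forall>x\<in>?P. act a x \<in> ?P}"
    unfolding subalgebra_def subspace_def
    by (auto simp: act_add_left act_scale act_mult act_one
        intro: MV.span_zero MV.span_add MV.span_scale)
  then have "subalgebra hull V \<subseteq> {a. \<forall>x\<in>?P. act a x \<in> ?P}"
    using stable_V by (intro hull_minimal) auto
  then have "submodule ?P"
    unfolding submodule_def using V(1) by (auto intro: MV.span_zero MV.span_add)
  moreover have "F \<subseteq> ?P"
  proof -
    have "(\<Union>k\<le>E. M k) \<subseteq> (\<Union>k. P k)" by (fastforce simp: P_def)
    then show ?thesis using F(2) MV.span_mono by blast
  qed
  ultimately have "submodule hull F \<subseteq> ?P"
    by (intro hull_minimal)
  then have "?P = UNIV" using F(1) by auto
  then have "P n = M n" by (rule MV.graded_space_component_eqI[OF grM subP PM])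
  moreover have "P n = MV.span (R n)" using n by (simp add: P_def)
  ultimately have "M n = MV.span (R n)" by (rule subst)
  then show ?thesis unfolding R_def .
qed

lemma component_subset_growth_space:
  assumes A: "graded_algebra A" "\<And>n. fin_dim scale (A n)"
    and M: "graded_module A M" "\<And>n. fin_dim mscale (M n)"
    and F: "generating_subspace F" and V: "frame V"
  shows "\<exists>r s. \<forall>n. M n \<subseteq> growth_space F V (r * n + s)"
proof -
  have one: "1 \<in> V" using V by (simp add: frame_def)
  have V_gen: "subalgebra hull V = UNIV" and V_fin: "fin_dim scale V"
    using V unfolding frame_def by blast+
  have F_gen: "submodule hull F = UNIV" and F_fin: "fin_dim mscale F"
    using F unfolding generating_subspace_def by blast+
  have grA: "graded_space scale A"
    using A(1) unfolding graded_algebra_def by blast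
  have grM: "graded_space mscale M"
    using M(1) unfolding graded_module_def by blast
  obtain D where D: "V \<subseteq> span (\<Union>i\<le>D. A i)"
    using graded_space_fin_dim_bounded_degree[OF grA V_fin] by blast
  obtain E where E: "F \<subseteq> MV.span (\<Union>i\<le>E. M i)"
    using MV.graded_space_fin_dim_bounded_degree[OF grM F_fin] by blast
  obtain BA where BA: "\<And>n. finite (BA n)" "\<And>n. span (BA n) = A n"
    using A(2) unfolding fin_dim_def by metis
  obtain BM where BM: "\<And>n. finite (BM n)" "\<And>n. MV.span (BM n) = M n"
    using M(2) unfolding fin_dim_def by metis
  have "\<exists>r. (\<Union>i\<le>D. BA i) \<subseteq> vpow V r"
    using BA(1) UN_vpow[OF V] by (intro finite_subset_chain_member mono_vpow one) auto
  then obtain r where "(\<Union>i\<le>D. BA i) \<subseteq> vpow V r" ..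
  then have r: "A i \<subseteq> vpow V r" if "i \<le> D" for i
    unfolding BA(2)[symmetric] using that by (intro span_minimal subspace_vpow) auto
  have "\<exists>s. (\<Union>i\<le>E. BM i) \<subseteq> growth_space F V s"
    using BM(1) UN_growth_space[OF F V]
    by (intro finite_subset_chain_member mono_growth_space one) auto
  then obtain s where "(\<Union>i\<le>E. BM i) \<subseteq> growth_space F V s" ..
  then have s: "M i \<subseteq> growth_space F V s" if "i \<le> E" for i
    unfolding BM(2)[symmetric] using that by (intro MV.span_minimal subspace_growth_space) auto
  have mono: "growth_space F V m \<subseteq> growth_space F V n" if "m \<le> n" for m n
    using monoD[OF mono_growth_space[OF one] that] .
  have "M n \<subseteq> growth_space F V (r * n + s)" for n
  proof (induction n rule: less_induct)
    case (less n)
    show ?case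
    proof (cases "n \<le> E")
      case True
      then show ?thesis using s[OF True] mono[of s "r * n + s"] by auto
    next
      case False
      have "act a x \<in> growth_space F V (r * n + s)"
        if "1 \<le> i" "i \<le> D" "i + j = n" "a \<in> A i" "x \<in> M j" for a x i j
      proof -
        have "x \<in> growth_space F V (r * j + s)" using less[of j] that by auto
        then have "act a x \<in> growth_space F V (r + (r * j + s))"
          using r[OF \<open>i \<le> D\<close>] \<open>a \<in> A i\<close> by (intro act_growth_space) auto
        moreover have "r + (r * j + s) \<le> r * n + s"
          using that by (cases i) (auto simp: algebra_simps)
        ultimately show ?thesis using mono by blast
      qed
      then have "MV.span {act a x | a x i j. 1 \<le> i \<and> i \<le> D \<and> i + j = n \<and> a \<in> A i \<and> x \<in> M j}
          \<subseteq> growth_space F V (r * n + s)"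
        by (intro MV.span_minimal subspace_growth_space) blast
      then show ?thesis
        using high_degree_recursion[OF A(1) M(1) F_gen E V_gen D, of n] False by simp
    qed
  qed
  then show ?thesis by (intro exI allI)
qed

lemma dim_component_le_growth:
  assumes "graded_algebra A" "\<And>n. fin_dim scale (A n)"
    and "graded_module A M" "\<And>n. fin_dim mscale (M n)"
    and "generating_subspace F" "frame V"
  shows "\<exists>r\<ge>1. \<exists>s. \<forall>n. MV.dim (M n) \<le> growth F V (r * n + s)"
proof -
  obtain r where "\<exists>s. \<forall>n. M n \<subseteq> growth_space F V (r * n + s)"
    using component_subset_growth_space[OF assms] ..
  then obtain s where rs: "\<forall>n. M n \<subseteq> growth_space F V (r * n + s)" ..
  have one: "1 \<in> V" and V_fin: "fin_dim scale V"
    using assms(6) unfolding frame_def by blast+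
  have F_fin: "fin_dim mscale F"
    using assms(5) unfolding generating_subspace_def by blast
  (* The increment keeps the slope positive, so that the bound r n + s tends to infinity. *)
  have "MV.dim (M n) \<le> growth F V (Suc r * n + s)" for n
  proof -
    obtain W where W: "finite W" "growth_space F V (Suc r * n + s) \<subseteq> MV.span W"
      using growth_space_finite_span[OF F_fin V_fin] by blast
    have "M n \<subseteq> growth_space F V (r * n + s)"
      using rs ..
    also have "growth_space F V (r * n + s) \<subseteq> growth_space F V (Suc r * n + s)"
      by (rule monoD[OF mono_growth_space[OF one]]) simp
    finally show ?thesis
      unfolding growth_eq_dim using W(2,1) by (rule MV.dim_mono_finite_span)
  qed
  then have "\<forall>n. MV.dim (M n) \<le> growth F V (Suc r * n + s)" ..
  moreover have "1 \<le> Suc r" by simp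
  ultimately show ?thesis by (intro exI conjI)
qed

end

section \<open>Exponential against polynomial growth\<close>

text \<open>If the limit superior of the logarithms were below some \<open>K\<close>, then eventually
  \<open>d\<^sub>n \<le> g (r n + s) < (r n + s)\<^sup>K < c\<^sup>n\<close> for every \<open>c > 1\<close>, so the roots of \<open>d\<^sub>n\<close> could
  not exceed \<open>1\<close> in the limit.\<close>

lemma limsup_log_eq_infinity:
  fixes d g :: "nat \<Rightarrow> nat"
  assumes "limsup (\<lambda>n. ereal (root n (real (d n)))) > 1"
    and "r \<ge> 1" and "\<And>n. d n \<le> g (r * n + s)"
  shows "limsup (\<lambda>n. ereal (log (real n) (real (g n)))) = \<infinity>"
proof (rule ccontr)
  assume "\<not> ?thesis"
  then obtain K where K: "limsup (\<lambda>n. ereal (log (real n) (real (g n)))) < ereal K"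
    using less_PInf_Ex_of_nat by fastforce
  have "eventually (\<lambda>n. ereal (log (real n) (real (g n))) < ereal K) sequentially"
    using Limsup_lessD[OF K] .
  moreover have lim: "filterlim (\<lambda>n. r * n + s) at_top sequentially"
    using assms(2)
    by (intro filterlim_at_top_mono[OF filterlim_ident] always_eventually allI trans_le_add1) simp
  ultimately have log_less:
    "eventually (\<lambda>n. log (real (r * n + s)) (real (g (r * n + s))) < K) sequentially"
    by (auto dest: eventually_compose_filterlim)
  obtain c where c: "1 < c" "ereal c < limsup (\<lambda>n. ereal (root n (real (d n))))"
    using ereal_dense2[OF assms(1)] by (auto simp: one_ereal_def)
  have "eventually (\<lambda>n. real (r * n + s) powr K < c ^ n) sequentially"
    using c(1) assms(2) by real_asymp
  moreover have "eventually (\<lambda>n. r * n + s > 1) sequentially"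
    using lim by (auto dest: eventually_compose_filterlim[OF eventually_gt_at_top])
  ultimately have "eventually (\<lambda>n. ereal (root n (real (d n))) \<le> ereal c) sequentially"
    using log_less eventually_gt_at_top[of 0]
  proof eventually_elim
    case (elim n)
    let ?N = "r * n + s"
    have "real (d n) < c ^ n"
    (* The logarithm bounds only positive values, as the formal logarithm of 0 is 0. *)
    proof (cases "g ?N = 0")
      case True
      then show ?thesis using assms(3)[of n] c(1) by simp
    next
      case False
      moreover have "real 1 < real ?N"
        unfolding of_nat_less_iff using elim by blast
      ultimately have "real (g ?N) < real ?N powr K"
        using elim log_less_iff[of "real ?N" "real (g ?N)" K] by simp
      then show ?thesis using assms(3)[of n] elim by linarith
    qed
    then have "root n (real (d n)) \<le> root n (c ^ n)"
      using elim by (intro real_root_le_mono) auto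
    then show ?case using elim c(1) by (simp add: real_root_power_cancel)
  qed
  then have "limsup (\<lambda>n. ereal (root n (real (d n)))) \<le> ereal c"
    by (rule Limsup_bounded)
  with c(2) show False by simp
qed

lemma limsup_root_ge_1:
  fixes d :: "nat \<Rightarrow> nat"
  assumes "\<And>N. \<exists>n\<ge>N. d n \<ge> 1"
  shows "limsup (\<lambda>n. ereal (root n (real (d n)))) \<ge> 1"
proof (rule ccontr)
  assume "\<not> ?thesis"
  then have "eventually (\<lambda>n. ereal (root n (real (d n))) < 1) sequentially"
    by (intro Limsup_lessD) auto
  then obtain N where N: "\<And>n. n \<ge> N \<Longrightarrow> root n (real (d n)) < 1"
    by (auto simp: eventually_sequentially)
  obtain n where n: "n \<ge> max N 1" "d n \<ge> 1" using assms by blast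
  then have "root n 1 \<le> root n (real (d n))"
    by (intro real_root_le_mono) auto
  with n N[of n] show False by auto
qed

section \<open>Entropy and Gelfand-Kirillov dimension\<close>

theorem theorem4p12:
  fixes scale :: "'k::field \<Rightarrow> 'a::ring_1 \<Rightarrow> 'a"
    and act :: "'a \<Rightarrow> 'm::ab_group_add \<Rightarrow> 'm"
    and A :: "nat \<Rightarrow> 'a set" and M :: "nat \<Rightarrow> 'm set"
  assumes "k_algebra scale" and "left_module act"
    and "k_algebra.affine_algebra scale"
    and "k_algebra.graded_algebra scale A"
    and "\<And>n. fin_dim scale (A n)"
    and "left_module.fin_gen act"
    and "k_algebra_module.graded_module scale act A M"
    and "\<And>n. fin_dim (k_algebra_module.mscale scale act) (M n)"
    and "\<not> fin_dim (k_algebra_module.mscale scale act) (UNIV :: 'm set)"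
  shows "(k_algebra_module.entropy scale act M > 1 \<longrightarrow>
            k_algebra_module.GKdim scale act = \<infinity>) \<and>
         (0 < k_algebra_module.GKdim scale act \<and> k_algebra_module.GKdim scale act < \<infinity> \<longrightarrow>
            k_algebra_module.entropy scale act M = 1)"
proof -
  interpret k_algebra_module scale act
    using assms(1,2) by (simp add: k_algebra_module_def)
  (* The dimension is computed by some pair F, V; the growth bound applies to whichever it is. *)
  have "\<exists>d F V. generating_subspace F \<and> frame V \<and> d = GKdim_wrt F V"
    using affine_algebra_frame_exists[OF assms(3)] fin_gen_generating_subspace_exists[OF assms(6)]
    by blast
  then have "\<exists>F V. generating_subspace F \<and> frame V \<and> GKdim = GKdim_wrt F V"
    unfolding GKdim_def by (rule someI_ex)
  then obtain F V where FV: "generating_subspace F" "frame V" "GKdim = GKdim_wrt F V" by blast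
  obtain r s where rs: "r \<ge> 1" "\<And>n. MV.dim (M n) \<le> growth F V (r * n + s)"
    using dim_component_le_growth[OF assms(4,5,7,8) FV(1,2)] by blast
  have a: "GKdim = \<infinity>" if "entropy M > 1"
    unfolding FV(3) GKdim_wrt_def using that[unfolded entropy_def] rs
    by (rule limsup_log_eq_infinity[where d = "\<lambda>n. MV.dim (M n)" and g = "growth F V"])
  have "graded_space mscale M"
    using assms(7) by (simp add: graded_module_def)
  then have "entropy M \<ge> 1"
    unfolding entropy_def using assms(8,9)
    by (intro limsup_root_ge_1 MV.graded_space_infinitely_many_nonzero)
  with a show ?thesis by (metis less_irrefl order_le_less)
qed

end
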